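(* Let $\mathcal{F}$ be a finite pairwise intersecting family of cosets of subgroups of $\mathbb{Z}$. Then $\mathcal{F}$ has non-empty intersection, that is, $\bigcap_{A\in\mathcal{F}}A\neq\emptyset$.
   Context: $\mathbb{Z}$ is the additive group of integers. Different members of $\mathcal{F}$ may be cosets of different subgroups. A family is pairwise intersecting if any two of its members have non-empty intersection. *)

theory Defs
  imports "HOL-Algebra.Elementary_Groups"
begin

end

theory Submission
  imports Defs "HOL-Computational_Algebra.Euclidean_Algorithm"
begin

text \<open>Cosets in \<open>\<int>\<close> are residue classes. In the divisibility lattice of the integers the gcd
  distributes over least common multiples, so a residue class that is compatible with each
  class of a family is also compatible with the common refinement of that family; by Bezout
  they then share an element.\<close>

text \<open>The generator is \<open>Gcd H\<close>. Everything rests on \<open>Gcd H \<in> H\<close>,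
  which division with remainder by the least positive element yields.\<close>

lemma subgroup_integer_group_eq_multiples:
  assumes "subgroup H integer_group"
  obtains m where "H = {x. m dvd x}"
proof
  have diff: "x - y \<in> H" if "x \<in> H" "y \<in> H" for x y
    using subgroup.m_closed[OF assms that(1) subgroup.m_inv_closed[OF assms that(2)]] by simp
  have zero: "0 \<in> H"
    using subgroup.one_closed[OF assms] by simp
  have neg: "- x \<in> H" if "x \<in> H" for x
    using diff[OF zero that] by simp
  have add: "x + y \<in> H" if "x \<in> H" "y \<in> H" for x y
    using diff[OF that(1) neg[OF that(2)]] by simp
  have nat_mult: "int n * x \<in> H" if "x \<in> H" for n x
    by (induction n) (use that zero add in \<open>auto simp: distrib_right\<close>)
  have mult: "k * x \<in> H" if "x \<in> H" for k x
    using nat_mult[OF that, of "nat \<bar>k\<bar>"] neg by (cases "k \<ge> 0") fastforce+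
  have "Gcd H \<in> H"
  proof (cases "H \<subseteq> {0}")
    case True
    \<comment> \<open>For the trivial subgroup the generator is 0, the value of
      \<open>Gcd {0}\<close>.\<close>
    then show ?thesis
      using zero by (metis Gcd_0_iff)
  next
    case False
    then obtain x where "x \<in> H" "x \<noteq> 0" by auto
    then have ex: "\<exists>n. n > 0 \<and> int n \<in> H"
      by (intro exI[of _ "nat \<bar>x\<bar>"]) (use neg in \<open>auto simp: abs_if\<close>)
    define n where "n = (LEAST n. n > 0 \<and> int n \<in> H)"
    have n: "n > 0" "int n \<in> H"
      using LeastI_ex[OF ex] by (auto simp: n_def)
    have "int n dvd y" if "y \<in> H" for y
    proof -
      have "y mod int n \<in> H"
        using diff[OF that mult[OF n(2), of "y div int n"]] by (simp add: minus_div_mult_eq_mod)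
      \<comment> \<open>The remainder is smaller than \<open>n\<close>, so a positive remainder in
        \<open>H\<close> would contradict minimality.\<close>
      moreover have "\<not> (0 < nat (y mod int n) \<and> int (nat (y mod int n)) \<in> H)"
        using n(1) not_less_Least[of "nat (y mod int n)" "\<lambda>n. n > 0 \<and> int n \<in> H"]
        unfolding n_def[symmetric] by (simp add: nat_less_iff)
      ultimately have "\<not> 0 < y mod int n"
        by auto
      moreover have "0 \<le> y mod int n"
        using n(1) by simp
      ultimately have "y mod int n = 0"
        by linarith
      then show ?thesis by auto
    qed
    \<comment> \<open>\<open>int n\<close> is a common divisor of \<open>H\<close> and, being a
      member, a multiple of every other one.\<close>
    then have "Gcd H = int n"
      using n(2) by (intro Gcd_eqI) auto
    then show ?thesis using n(2) by simp
  qed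
  then show "H = {x. Gcd H dvd x}"
    using mult by (auto elim!: dvdE simp: mult.commute[of "Gcd H"])
qed

lemma rcoset_integer_group_eq_residue_class:
  assumes "subgroup H integer_group" and "A \<in> rcosets\<^bsub>integer_group\<^esub> H"
  obtains m a where "A = {x. m dvd x - a}"
proof -
  obtain m where m: "H = {x. m dvd x}"
    using subgroup_integer_group_eq_multiples[OF assms(1)] .
  obtain a where "A = {h + a | h. h \<in> H}"
    using assms(2) by (auto simp: RCOSETS_def r_coset_def)
  then have "A = {x. m dvd x - a}"
    unfolding m by (auto intro: exI[of _ "_ - a"])
  then show thesis using that by blast
qed

text \<open>Induction with \<open>gcd l (lcm x y) = lcm (gcd l x) (gcd l y)\<close>. For empty
  \<open>I\<close> the \<open>Lcm\<close> is 1, so the gcd is 1 as well.\<close>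

lemma gcd_Lcm_dvdI:
  fixes f :: "'a \<Rightarrow> int"
  assumes "finite I" and "\<And>i. i \<in> I \<Longrightarrow> gcd l (f i) dvd c"
  shows "gcd l (Lcm (f ` I)) dvd c"
  using assms
proof (induction I rule: finite_induct)
  case (insert i I)
  then show ?case
    by (simp add: gcd_lcm_distrib lcm_least)
qed simp

lemma gcd_dvd_diff_iff_residue_classes_meet:
  fixes m n a b :: int
  shows "gcd m n dvd a - b \<longleftrightarrow> (\<exists>x. m dvd x - a \<and> n dvd x - b)"
proof
  assume "gcd m n dvd a - b"
  then obtain k where k: "a - b = gcd m n * k" ..
  obtain u v where "u * m + v * n = gcd m n"
    using bezout_int by blast
  then have "a - b = u * m * k + v * n * k"
    using k by (simp flip: distrib_right)
  \<comment> \<open>Splitting the Bezout combination puts a multiple of \<open>m\<close> next to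
    \<open>a\<close>, which gives the common element.\<close>
  then have "a - u * m * k - b = v * n * k"
    by linarith
  then show "\<exists>x. m dvd x - a \<and> n dvd x - b"
    by (intro exI[of _ "a - u * m * k"]) auto
next
  assume "\<exists>x. m dvd x - a \<and> n dvd x - b"
  then obtain x where "m dvd x - a" "n dvd x - b" by blast
  then have "gcd m n dvd (x - b) - (x - a)"
    by (meson dvd_diff gcd_dvd1 gcd_dvd2 dvd_trans)
  then show "gcd m n dvd a - b" by simp
qed

lemma residue_classes_Helly:
  fixes m a :: "'a \<Rightarrow> int"
  assumes "finite I"
    and "\<And>i j. i \<in> I \<Longrightarrow> j \<in> I \<Longrightarrow> gcd (m i) (m j) dvd a i - a j"
  shows "\<exists>x. \<forall>i\<in>I. m i dvd x - a i"
  using assms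
proof (induction I rule: finite_induct)
  case (insert i I)
  then obtain x where x: "\<And>j. j \<in> I \<Longrightarrow> m j dvd x - a j"
    by auto
  \<comment> \<open>The representative \<open>a j\<close> may be replaced by \<open>x\<close>, since
    they agree modulo \<open>m j\<close>. Now a single \<open>x\<close> serves all \<open>j\<close>,
    as the passage to the \<open>Lcm\<close> requires.\<close>
  have "gcd (m i) (m j) dvd a i - x" if "j \<in> I" for j
  proof -
    have "gcd (m i) (m j) dvd (a i - a j) - (x - a j)"
      using insert.prems[of i j] x[OF that] that
      by (meson dvd_diff dvd_trans gcd_dvd2 insertCI)
    then show ?thesis by simp
  qed
  then have "gcd (m i) (Lcm (m ` I)) dvd a i - x"
    using insert.hyps by (intro gcd_Lcm_dvdI) auto
  then obtain y where y: "m i dvd y - a i" "Lcm (m ` I) dvd y - x"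
    unfolding gcd_dvd_diff_iff_residue_classes_meet by blast
  \<comment> \<open>Moving from \<open>x\<close> to \<open>y\<close> changes nothing modulo any
    \<open>m j\<close>, because each divides the \<open>Lcm\<close>.\<close>
  have "m j dvd y - a j" if "j \<in> I" for j
  proof -
    have "m j dvd (y - x) + (x - a j)"
      using y(2) x[OF that] that by (meson dvd_Lcm dvd_add dvd_trans imageI)
    then show ?thesis by simp
  qed
  with y(1) show ?case by auto
qed simp

theorem theorem4:
  fixes F :: "int set set"
  assumes "finite F"
    and "\<And>A. A \<in> F \<Longrightarrow> \<exists>H. subgroup H integer_group \<and> A \<in> rcosets\<^bsub>integer_group\<^esub> H"
    and "pairwise (\<lambda>A B. A \<inter> B \<noteq> {}) F"
  shows "\<Inter>F \<noteq> {}"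
proof -
  have "\<exists>m a. A = {x. m dvd x - a}" if "A \<in> F" for A
    using assms(2)[OF that] rcoset_integer_group_eq_residue_class by metis
  \<comment> \<open>The cosets index their own moduli and representatives, so \<open>F\<close>
    itself can serve as the index set.\<close>
  then obtain m a where eq: "\<And>A. A \<in> F \<Longrightarrow> A = {x. m A dvd x - a A}"
    by metis
  have "gcd (m A) (m B) dvd a A - a B" if "A \<in> F" "B \<in> F" for A B
  \<comment> \<open>\<open>pairwise\<close> speaks of distinct members only; for equal ones the
    difference is 0.\<close>
  proof (cases "A = B")
    case False
    then have "A \<inter> B \<noteq> {}"
      using pairwiseD(1)[OF assms(3) that] by simp
    then obtain x where "x \<in> A" "x \<in> B"
      by blast
    then have "m A dvd x - a A" "m B dvd x - a B"
      using eq[OF that(1)] eq[OF that(2)] by auto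
    then show ?thesis
      unfolding gcd_dvd_diff_iff_residue_classes_meet by blast
  qed simp
  from residue_classes_Helly[where m = m and a = a, OF assms(1) this]
  obtain x where "\<And>A. A \<in> F \<Longrightarrow> m A dvd x - a A" by blast
  then have "x \<in> A" if "A \<in> F" for A
    using that by (subst eq) auto
  then show ?thesis by blast
qed

end
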